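(* For every $M>0$ there exists an instance of the battery-sharing model described in the context (a number of users $n$, a net generation Markov chain $X(\cdot)$, and a battery capacity $b_{\max}$) in which all users are net generative, i.e. $\Delta_i>0$ for all $i\in[n]$, and whose price of fairness satisfies $\mathrm{PoF}\ge M$.
   Context: Notation: $[n]=\{1,\dots,n\}$; $\mathbb{I}\{\cdot\}$ denotes an indicator. Net generation. There are $n$ users. The net generation of user $i$ at discrete time $t$ is $X_i(t)\in S_i$ (positive: surplus; negative: deficit), where $S_i$ has $\max S_i>0$ and $\min S_i<0$; energy is measured with an arbitrary positive granularity, taken to be unity, so that $S_i\subset\mathbb{Z}$. The vector $X(t)=(X_1(t),\dots,X_n(t))$ is an irreducible discrete-time Markov chain on a finite state space $S\subseteq\prod_{i\in[n]}S_i$, with $\mathbb{P}[X(t+1)=s\mid X(t)=s]>0$ for all $s\in S$. (More generally, the vector of net generations may be a function of such a background Markov chain.) Its stationary distribution is $\pi$. The drift of user $i$ is $\Delta_i=\sum_{s\in S}s_i\pi(s)$, where $s=(s_1,\dots,s_n)$. Battery. A shared battery of capacity $b_{\max}\in\mathbb{N}$ has level $B(t)\in\{0,\dots,b_{\max}\}$ and evolves as $B(t+1)=B(t)+\sum_{i\in[n]}A_i(t)$, where $A_i(t)$ is the energy accepted from user $i$ (if $\ge0$) or supplied to user $i$ (if negative). In state $(x,b)\in S\times\{0,\dots,b_{\max}\}$ the set $A(x,b)$ of allowable actions consists of all integer vectors $(a_1,\dots,a_n)$ with $a_i\in\{0,\dots,x_i\}$ if $x_i\ge0$, $a_i\in\{x_i,\dots,0\}$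 if $x_i<0$, and $0\le b+\sum_{i}a_i\le b_{\max}$. A policy is a (possibly randomized, history-dependent) rule choosing at each time $t$ an action in $A(X(t),B(t))$ as a function of the history up to time $t$; the process $X$ evolves autonomously, unaffected by actions. The initial distribution of $(X(0),B(0))$ is fixed. Loss of load rate: $\mathrm{LLR}_i=\lim_{T\to\infty}\frac1T\sum_{t=0}^T\mathbb{E}\big[\mathbb{I}\{X_i(t)<0\}(A_i(t)-X_i(t))\big]$ and $\mathrm{LLR}_{\rm sys}=\sum_{i\in[n]}\mathrm{LLR}_i$. $\mathrm{LLR}_o$ is the minimum of $\mathrm{LLR}_{\rm sys}$ over all policies satisfying, for every $i\in[n]$, the fairness constraint $\lim_{T\to\infty}\frac1T\sum_{t=0}^T\mathbb{E}[A_i(t)]\ge0$. $\mathrm{LLR}_e$ is the minimum of $\mathrm{LLR}_{\rm sys}$ over all policies (without the fairness constraint). The price of fairness is $\mathrm{PoF}=\mathrm{LLR}_o/\mathrm{LLR}_e$. *)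

theory Defs
  imports "HOL-Probability.Probability"
begin

text \<open>
  Vectors indexed by the users \<open>1, \<dots>, n\<close> are functions on \<open>nat\<close> that are extensional on
  \<open>{1..n}\<close> (i.e. \<open>undefined\<close> elsewhere), so that equality of vectors is equality on \<open>{1..n}\<close>.
\<close>

type_synonym vec = "nat \<Rightarrow> int"

record battery_model =
  num_users :: nat
  states :: "vec set"
  trans :: "vec \<Rightarrow> vec pmf"
  capacity :: nat

abbreviation users :: "battery_model \<Rightarrow> nat set" where
  "users m \<equiv> {1..num_users m}"

text \<open>
  The set of values \<open>S\<^sub>i\<close> of user \<open>i\<close> is the projection of the state space to coordinate \<open>i\<close>.
  The transition law \<open>trans m s\<close> is relevant only for \<open>s \<in> states m\<close>.
\<close>

definition user_values :: "battery_model \<Rightarrow> nat \<Rightarrow> int set" where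
  "user_values m i = (\<lambda>s. s i) ` states m"

definition irreducible_chain :: "battery_model \<Rightarrow> bool" where
  "irreducible_chain m \<longleftrightarrow>
     (\<forall>s\<in>states m. \<forall>s'\<in>states m. (s, s') \<in> {(u, v). pmf (trans m u) v > 0}\<^sup>*)"

definition valid_model :: "battery_model \<Rightarrow> bool" where
  "valid_model m \<longleftrightarrow>
     num_users m \<ge> 1 \<and> capacity m \<ge> 1 \<and>
     finite (states m) \<and> states m \<noteq> {} \<and> states m \<subseteq> extensional (users m) \<and>
     (\<forall>i\<in>users m. Max (user_values m i) > 0 \<and> Min (user_values m i) < 0) \<and>
     (\<forall>s\<in>states m. set_pmf (trans m s) \<subseteq> states m) \<and>
     irreducible_chain m \<and>
     (\<forall>s\<in>states m. pmf (trans m s) s > 0)"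

definition stationary :: "battery_model \<Rightarrow> vec pmf \<Rightarrow> bool" where
  "stationary m p \<longleftrightarrow> set_pmf p \<subseteq> states m \<and> bind_pmf p (trans m) = p"

definition drift :: "battery_model \<Rightarrow> vec pmf \<Rightarrow> nat \<Rightarrow> real" where
  "drift m p i = (\<Sum>s\<in>states m. real_of_int (s i) * pmf p s)"

definition initial_distribution :: "battery_model \<Rightarrow> (vec \<times> int) pmf \<Rightarrow> bool" where
  "initial_distribution m \<nu> \<longleftrightarrow> set_pmf \<nu> \<subseteq> states m \<times> {0..int (capacity m)}"

definition allowable :: "battery_model \<Rightarrow> vec \<Rightarrow> int \<Rightarrow> vec set" where
  "allowable m x b =
     {a \<in> extensional (users m).
        (\<forall>i\<in>users m. if x i \<ge> 0 then a i \<in> {0..x i} else a i \<in> {x i..0}) \<and>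
        0 \<le> b + (\<Sum>i\<in>users m. a i) \<and> b + (\<Sum>i\<in>users m. a i) \<le> int (capacity m)}"

text \<open>
  A policy maps the past \<open>(X(t-1), B(t-1), A(t-1)), \<dots>, (X(0), B(0), A(0))\<close> (a list, most recent
  entry first) and the current \<open>X(t)\<close> and \<open>B(t)\<close> to a distribution on actions. Past actions
  belong to the history, so dependence between randomizations at different times is covered.
\<close>

type_synonym history = "(vec \<times> int \<times> vec) list"
type_synonym policy = "history \<Rightarrow> vec \<Rightarrow> int \<Rightarrow> vec pmf"

definition policies :: "battery_model \<Rightarrow> policy set" where
  "policies m =
     {\<phi>. \<forall>h. \<forall>x\<in>states m. \<forall>b\<in>{0..int (capacity m)}. set_pmf (\<phi> h x b) \<subseteq> allowable m x b}"

text \<open>The law of the history up to and including the action at time \<open>t\<close>.\<close>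

primrec history_law ::
  "battery_model \<Rightarrow> (vec \<times> int) pmf \<Rightarrow> policy \<Rightarrow> nat \<Rightarrow> history pmf" where
  "history_law m \<nu> \<phi> 0 =
     bind_pmf \<nu> (\<lambda>(x, b). map_pmf (\<lambda>a. [(x, b, a)]) (\<phi> [] x b))"
| "history_law m \<nu> \<phi> (Suc t) =
     bind_pmf (history_law m \<nu> \<phi> t) (\<lambda>h.
       case hd h of (x, b, a) \<Rightarrow>
         bind_pmf (trans m x) (\<lambda>x'.
           let b' = b + (\<Sum>i\<in>users m. a i)
           in map_pmf (\<lambda>a'. (x', b', a') # h) (\<phi> h x' b')))"

definition expect_at ::
  "battery_model \<Rightarrow> (vec \<times> int) pmf \<Rightarrow> policy \<Rightarrow> (vec \<Rightarrow> int \<Rightarrow> vec \<Rightarrow> real) \<Rightarrow> nat \<Rightarrow> real" where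
  "expect_at m \<nu> \<phi> f t =
     measure_pmf.expectation (history_law m \<nu> \<phi> t) (\<lambda>h. case hd h of (x, b, a) \<Rightarrow> f x b a)"

definition has_time_average :: "(nat \<Rightarrow> real) \<Rightarrow> real \<Rightarrow> bool" where
  "has_time_average f L \<longleftrightarrow> (\<lambda>T. 1 / real T * (\<Sum>t=0..T. f t)) \<longlonglongrightarrow> L"

definition has_LLR ::
  "battery_model \<Rightarrow> (vec \<times> int) pmf \<Rightarrow> policy \<Rightarrow> nat \<Rightarrow> real \<Rightarrow> bool" where
  "has_LLR m \<nu> \<phi> i L \<longleftrightarrow>
     has_time_average
       (expect_at m \<nu> \<phi> (\<lambda>x b a. of_bool (x i < 0) * real_of_int (a i - x i))) L"

definition has_LLR_sys ::
  "battery_model \<Rightarrow> (vec \<times> int) pmf \<Rightarrow> policy \<Rightarrow> real \<Rightarrow> bool" where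
  "has_LLR_sys m \<nu> \<phi> L \<longleftrightarrow>
     (\<exists>l. (\<forall>i\<in>users m. has_LLR m \<nu> \<phi> i (l i)) \<and> L = (\<Sum>i\<in>users m. l i))"

definition fair :: "battery_model \<Rightarrow> (vec \<times> int) pmf \<Rightarrow> policy \<Rightarrow> bool" where
  "fair m \<nu> \<phi> \<longleftrightarrow>
     (\<forall>i\<in>users m. \<exists>c\<ge>0. has_time_average (expect_at m \<nu> \<phi> (\<lambda>x b a. real_of_int (a i))) c)"

definition is_minimum :: "real \<Rightarrow> real set \<Rightarrow> bool" where
  "is_minimum r R \<longleftrightarrow> r \<in> R \<and> (\<forall>r'\<in>R. r \<le> r')"

text \<open>The minima range over the policies for which the defining limits exist.\<close>

definition is_LLR_o :: "battery_model \<Rightarrow> (vec \<times> int) pmf \<Rightarrow> real \<Rightarrow> bool" where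
  "is_LLR_o m \<nu> r \<longleftrightarrow>
     is_minimum r {L. \<exists>\<phi>\<in>policies m. fair m \<nu> \<phi> \<and> has_LLR_sys m \<nu> \<phi> L}"

definition is_LLR_e :: "battery_model \<Rightarrow> (vec \<times> int) pmf \<Rightarrow> real \<Rightarrow> bool" where
  "is_LLR_e m \<nu> r \<longleftrightarrow> is_minimum r {L. \<exists>\<phi>\<in>policies m. has_LLR_sys m \<nu> \<phi> L}"

text \<open>The quotient is only considered when the denominator is nonzero.\<close>

definition is_PoF :: "battery_model \<Rightarrow> (vec \<times> int) pmf \<Rightarrow> real \<Rightarrow> bool" where
  "is_PoF m \<nu> q \<longleftrightarrow>
     (\<exists>lo le. is_LLR_o m \<nu> lo \<and> is_LLR_e m \<nu> le \<and> le \<noteq> 0 \<and> q = lo / le)"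

end

theory Submission
  imports Defs
begin

text \<open>
  Take two users and independent, identically distributed net generation: \<open>(1, -1)\<close> with probability
  \<open>3/4 - \<epsilon>\<close>, \<open>(0, -1)\<close> with probability \<open>\<epsilon>\<close>, \<open>(-1, 4)\<close> with probability \<open>1/4\<close>; the battery has
  capacity 1. Without fairness user 1 serves user 2 directly, and load is lost only in the rare state
  \<open>(0, -1)\<close> with an empty battery. With fairness user 2 must repay what it receives, but its surplus
  comes in bursts: in state \<open>(-1, 4)\<close> it can pass on at most one unit to user 1 and store one unit,
  so most of its demand stays unserved however small \<open>\<epsilon>\<close> is.

  Both minima are computed exactly. The upper bounds come from explicit policies, under which the mean
  battery level follows an affine recursion. The lower bounds come from a potential linear in the
  battery level, plus a Lagrange multiplier for the fairness of user 2, so that the bound holds in each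
  step conditionally on the past and the potential telescopes in the time average.
\<close>

section \<open>Expectations under finitely supported laws\<close>

lemma expectation_bind_pmf_finite:
  fixes f :: "'b \<Rightarrow> real"
  assumes "finite (set_pmf p)" "\<And>x. x \<in> set_pmf p \<Longrightarrow> finite (set_pmf (k x))"
  shows "measure_pmf.expectation (bind_pmf p k) f =
           measure_pmf.expectation p (\<lambda>x. measure_pmf.expectation (k x) f)"
  using assms
  by (subst pmf_expectation_bind[of "set_pmf p"])
     (auto simp: integral_measure_pmf[of "set_pmf p"])

lemma expectation_mono_pmf_finite:
  fixes f g :: "'a \<Rightarrow> real"
  assumes "finite (set_pmf p)" "\<And>x. x \<in> set_pmf p \<Longrightarrow> f x \<le> g x"
  shows "measure_pmf.expectation p f \<le> measure_pmf.expectation p g"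
  using assms by (intro integral_mono_AE integrable_measure_pmf_finite) (auto simp: AE_measure_pmf_iff)

section \<open>Time averages\<close>

lemma has_time_average_diff:
  assumes "has_time_average f K" "has_time_average g L"
  shows "has_time_average (\<lambda>t. f t - g t) (K - L)"
  using tendsto_diff[OF assms[unfolded has_time_average_def]]
  by (simp add: has_time_average_def sum_subtractf right_diff_distrib)

lemma has_time_average_sum:
  assumes "\<And>i. i \<in> I \<Longrightarrow> has_time_average (f i) (l i)"
  shows "has_time_average (\<lambda>t. \<Sum>i\<in>I. f i t) (\<Sum>i\<in>I. l i)"
proof -
  have "(\<lambda>T. \<Sum>i\<in>I. 1 / real T * (\<Sum>t=0..T. f i t)) \<longlonglongrightarrow> (\<Sum>i\<in>I. l i)"
    using assms by (intro tendsto_sum) (simp add: has_time_average_def)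
  then show ?thesis
    unfolding has_time_average_def
    by (subst sum.swap) (simp only: sum_distrib_left)
qed

lemma has_time_average_mono:
  assumes "has_time_average f K" "has_time_average g L" "\<And>t. f t \<le> g t"
  shows "K \<le> L"
  using assms(1,2) unfolding has_time_average_def
  by (rule LIMSEQ_le) (auto intro!: exI[of _ 0] divide_right_mono sum_mono assms(3))

text \<open>From time 1 on, \<open>f\<close> is a constant plus increments of a bounded sequence;
  these add up to at most a bounded quantity and vanish after division by \<open>T\<close>. The
  value \<open>f 0\<close> is left free because it depends on the initial distribution.\<close>

lemma has_time_average_telescope:
  fixes f q :: "nat \<Rightarrow> real"
  assumes bound: "\<And>t. \<bar>q t\<bar> \<le> C"
    and step: "\<And>t. f (Suc t) = g + c * (q (Suc t) - q t)"
  shows "has_time_average f g"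
proof -
  \<comment> \<open>The sum has \<open>T + 1\<close> terms; the one at time 0 is kept apart, so
    \<open>g\<close> occurs exactly \<open>T\<close> times, matching the normalisation by
    \<open>T\<close>.\<close>
  have sum: "(\<Sum>t=0..T. f t) = f 0 + real T * g + c * (q T - q 0)" for T
    by (induction T) (simp_all add: step algebra_simps)
  have C: "C \<ge> 0" using bound[of 0] by linarith
  have "(\<lambda>T. 1 / real T * (f 0 + c * (q T - q 0))) \<longlonglongrightarrow> 0"
  proof (rule Lim_null_comparison)
    show "\<forall>\<^sub>F T in sequentially. norm (1 / real T * (f 0 + c * (q T - q 0)))
            \<le> (\<bar>f 0\<bar> + \<bar>c\<bar> * (2 * C)) / real T"
    proof (intro always_eventually allI)
      fix T
      have "\<bar>q T - q 0\<bar> \<le> 2 * C" using bound[of T] bound[of 0] by linarith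
      then have "\<bar>c * (q T - q 0)\<bar> \<le> \<bar>c\<bar> * (2 * C)"
        by (simp add: abs_mult mult_left_mono)
      then have "\<bar>f 0 + c * (q T - q 0)\<bar> \<le> \<bar>f 0\<bar> + \<bar>c\<bar> * (2 * C)" by linarith
      then show "norm (1 / real T * (f 0 + c * (q T - q 0)))
            \<le> (\<bar>f 0\<bar> + \<bar>c\<bar> * (2 * C)) / real T"
        by (simp add: abs_mult divide_right_mono)
    qed
    show "(\<lambda>T. (\<bar>f 0\<bar> + \<bar>c\<bar> * (2 * C)) / real T) \<longlonglongrightarrow> 0"
      by (rule lim_const_over_n)
  qed
  then have "(\<lambda>T. 1 / real T * (f 0 + c * (q T - q 0)) + g) \<longlonglongrightarrow> 0 + g"
    by (intro tendsto_intros)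
  moreover have "\<forall>\<^sub>F T in sequentially.
      1 / real T * (f 0 + c * (q T - q 0)) + g = 1 / real T * (\<Sum>t=0..T. f t)"
    \<comment> \<open>At \<open>T = 0\<close> the convention \<open>1 / 0 = 0\<close> makes the left
      side \<open>g\<close> and the right side 0.\<close>
    using eventually_gt_at_top[of 0]
    by eventually_elim (simp add: sum field_simps)
  ultimately show ?thesis
    unfolding has_time_average_def by (simp add: tendsto_cong)
qed

text \<open>Comparison with the sequence \<open>?u\<close> that starts at \<open>f 0\<close> and
  satisfies the step inequality with equality: its time average is \<open>g\<close>.\<close>

lemma has_time_average_ge_telescope:
  fixes f q :: "nat \<Rightarrow> real"
  assumes "has_time_average f L" and "\<And>t. \<bar>q t\<bar> \<le> C"
    and step: "\<And>t. f (Suc t) \<ge> g + c * (q (Suc t) - q t)"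
  shows "L \<ge> g"
proof (rule has_time_average_mono)
  let ?u = "\<lambda>t. case t of 0 \<Rightarrow> f 0 | Suc s \<Rightarrow> g + c * (q (Suc s) - q s)"
  show "has_time_average ?u g"
    by (rule has_time_average_telescope[where q = q and C = C and c = c]) (auto simp: assms(2))
  show "?u t \<le> f t" for t
    using step by (auto split: nat.split)
qed (fact assms(1))

section \<open>Laws of histories and mean battery levels under a policy\<close>

definition next_level :: "battery_model \<Rightarrow> int \<Rightarrow> vec \<Rightarrow> int" where
  "next_level m b a = b + (\<Sum>i\<in>users m. a i)"

definition load_loss :: "vec \<Rightarrow> vec \<Rightarrow> nat \<Rightarrow> real" where
  "load_loss x a i = of_bool (x i < 0) * real_of_int (a i - x i)"

locale controlled_battery =
  fixes m :: battery_model and \<nu> :: "(vec \<times> int) pmf" and \<phi> :: policy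
  assumes valid: "valid_model m"
    and initial: "initial_distribution m \<nu>"
    and policy: "\<phi> \<in> policies m"
begin

definition law :: "nat \<Rightarrow> history pmf" where
  "law = history_law m \<nu> \<phi>"

definition expected :: "(vec \<Rightarrow> int \<Rightarrow> vec \<Rightarrow> real) \<Rightarrow> nat \<Rightarrow> real" where
  "expected = expect_at m \<nu> \<phi>"

text \<open>As the level is taken after the action, \<open>level t\<close> is the mean of B(t+1),
  the level seen by the action at time t+1.\<close>

definition level :: "nat \<Rightarrow> real" where
  "level = expected (\<lambda>x b a. real_of_int (next_level m b a))"

lemma allowed: "x \<in> states m \<Longrightarrow> b \<in> {0..int (capacity m)} \<Longrightarrow> a \<in> set_pmf (\<phi> h x b) \<Longrightarrow> a \<in> allowable m x b"
  using policy unfolding policies_def by blast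

lemma trans_states: "x \<in> states m \<Longrightarrow> y \<in> set_pmf (trans m x) \<Longrightarrow> y \<in> states m"
  using valid by (auto simp: valid_model_def)

lemma finite_states: "finite (states m)"
  using valid by (simp add: valid_model_def)

lemma next_level_in: "a \<in> allowable m x b \<Longrightarrow> next_level m b a \<in> {0..int (capacity m)}"
  by (auto simp: allowable_def next_level_def)

text \<open>Policies and the chain are constrained only at genuine states and levels, so membership
  in these sets has to be carried along the history by induction.\<close>

lemma hd_law:
  assumes "h \<in> set_pmf (law t)"
  shows "hd h \<in> {(x, b, a). x \<in> states m \<and> b \<in> {0..int (capacity m)} \<and> a \<in> allowable m x b}"
  using assms unfolding law_def
proof (induction t arbitrary: h)
  case 0
  then show ?case using initial allowed by (fastforce simp: initial_distribution_def)
next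
  case (Suc t)
  from Suc.prems obtain h0 where h0: "h0 \<in> set_pmf (history_law m \<nu> \<phi> t)"
    and h: "h \<in> set_pmf (case hd h0 of (x, b, a) \<Rightarrow> trans m x \<bind> (\<lambda>x'.
        let b' = b + sum a (users m) in map_pmf (\<lambda>a'. (x', b', a') # h0) (\<phi> h0 x' b')))"
    by auto
  obtain x b a where hd: "hd h0 = (x, b, a)" by (rule prod_cases3)
  from h obtain x' a' where x': "x' \<in> set_pmf (trans m x)"
    and a': "a' \<in> set_pmf (\<phi> h0 x' (next_level m b a))" and h: "h = (x', next_level m b a, a') # h0"
    by (auto simp: hd Let_def next_level_def)
  from Suc.IH[OF h0] hd have 1: "x \<in> states m" "a \<in> allowable m x b" by auto
  then have "x' \<in> states m" "next_level m b a \<in> {0..int (capacity m)}"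
    using trans_states x' next_level_in by blast+
  then show ?case using allowed[OF _ _ a'] by (simp add: h)
qed

lemma hd_lawE:
  assumes "h \<in> set_pmf (law t)"
  obtains x b a where "hd h = (x, b, a)" "x \<in> states m" "b \<in> {0..int (capacity m)}" "a \<in> allowable m x b"
  using hd_law[OF assms] by auto

lemma finite_allowable: "finite (allowable m x b)"
proof (rule finite_subset)
  show "allowable m x b \<subseteq> (\<Pi>\<^sub>E i\<in>users m. {- \<bar>x i\<bar>..\<bar>x i\<bar>})"
    by (force simp: allowable_def PiE_def Pi_def split: if_splits)
qed (auto intro: finite_PiE)

lemma finite_policy: "x \<in> states m \<Longrightarrow> b \<in> {0..int (capacity m)} \<Longrightarrow> finite (set_pmf (\<phi> h x b))"
  using finite_subset[OF _ finite_allowable] allowed by blast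

lemma finite_trans: "x \<in> states m \<Longrightarrow> finite (set_pmf (trans m x))"
  using finite_subset[OF _ finite_states] trans_states by blast

text \<open>Each step branches finitely often; hence every function is integrable below.\<close>

lemma finite_law: "finite (set_pmf (law t))"
proof (induction t)
  case 0
  have "finite (set_pmf \<nu>)"
    using initial finite_states by (auto simp: initial_distribution_def intro: finite_subset)
  then show ?case using initial finite_policy
    by (auto simp: law_def initial_distribution_def)
next
  case (Suc t)
  show ?case unfolding law_def history_law.simps set_bind_pmf
  proof (rule finite_UN_I)
    fix h assume "h \<in> set_pmf (history_law m \<nu> \<phi> t)"
    then obtain x b a where h: "hd h = (x, b, a)" "x \<in> states m" "a \<in> allowable m x b"
      using hd_lawE[of h t] by (metis law_def)
    then show "finite (set_pmf (case hd h of (x, b, a) \<Rightarrow> trans m x \<bind> (\<lambda>x'.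
        let b' = b + sum a (users m) in map_pmf (\<lambda>a'. (x', b', a') # h) (\<phi> h x' b'))))"
      using finite_trans[OF h(2)] finite_policy trans_states[OF h(2)] next_level_in[OF h(3)]
      by (auto simp: Let_def next_level_def)
  qed (use Suc law_def in simp)
qed

lemma expected_alt:
  "expected f t = measure_pmf.expectation (law t) (\<lambda>h. case hd h of (x, b, a) \<Rightarrow> f x b a)"
  by (simp add: expected_def expect_at_def law_def)

lemma expected_add: "expected (\<lambda>x b a. f x b a + g x b a) t = expected f t + expected g t"
  unfolding expected_alt
  by (subst Bochner_Integration.integral_add[symmetric])
     (auto intro!: integrable_measure_pmf_finite finite_law Bochner_Integration.integral_cong split: prod.splits)

lemma expected_sum: "expected (\<lambda>x b a. \<Sum>i\<in>I. f i x b a) t = (\<Sum>i\<in>I. expected (f i) t)"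
  unfolding expected_alt
  by (subst Bochner_Integration.integral_sum[symmetric])
     (auto intro!: integrable_measure_pmf_finite finite_law Bochner_Integration.integral_cong split: prod.splits)

lemma expected_cmult: "expected (\<lambda>x b a. c * f x b a) t = c * expected f t"
  unfolding expected_alt
  by (simp add: case_prod_beta)

lemma expected_Suc:
  "expected f (Suc t) = measure_pmf.expectation (law t) (\<lambda>h. case hd h of (x, b, a) \<Rightarrow>
     measure_pmf.expectation (trans m x) (\<lambda>x'.
       measure_pmf.expectation (\<phi> h x' (next_level m b a)) (f x' (next_level m b a))))"
proof -
  let ?F = "\<lambda>h. case hd h of (x, b, a) \<Rightarrow> f x b a"
  define K where "K = (\<lambda>h. case hd h of (x, b, a) \<Rightarrow> bind_pmf (trans m x) (\<lambda>x'.
         map_pmf (\<lambda>a'. (x', next_level m b a, a') # h) (\<phi> h x' (next_level m b a))))"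
  have law: "law (Suc t) = bind_pmf (law t) K"
    by (simp add: law_def K_def Let_def next_level_def)
  have *: "finite (set_pmf (K h)) \<and> measure_pmf.expectation (K h) ?F = (case hd h of (x, b, a) \<Rightarrow>
     measure_pmf.expectation (trans m x) (\<lambda>x'.
       measure_pmf.expectation (\<phi> h x' (next_level m b a)) (f x' (next_level m b a))))"
    if h: "h \<in> set_pmf (law t)" for h
  proof -
    obtain x b a where h: "hd h = (x, b, a)" "x \<in> states m" "a \<in> allowable m x b"
      using hd_lawE[OF h] by metis
    have fin: "finite (set_pmf (\<phi> h x' (next_level m b a)))" if "x' \<in> set_pmf (trans m x)" for x'
      using finite_policy trans_states[OF h(2) that] next_level_in[OF h(3)] by blast
    show ?thesis
      using finite_trans[OF h(2)] fin
      by (simp add: K_def h(1) expectation_bind_pmf_finite)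
  qed
  show ?thesis
    unfolding expected_alt law
    by (subst expectation_bind_pmf_finite)
       (use * finite_law in \<open>auto intro!: integral_cong_AE simp: AE_measure_pmf_iff\<close>)
qed

lemma level_in: "level t \<in> {0..real (capacity m)}"
proof -
  have *: "(case hd h of (x, b, a) \<Rightarrow> real_of_int (next_level m b a)) \<in> {0..real (capacity m)}"
    if h: "h \<in> set_pmf (law t)" for h
  proof -
    obtain x b a where "hd h = (x, b, a)" "a \<in> allowable m x b"
      using hd_lawE[OF h] by metis
    then show ?thesis using next_level_in[of a x b] by simp
  qed
  have "measure_pmf.expectation (law t) (\<lambda>h. 0) \<le> level t"
    unfolding level_def expected_alt
    by (intro expectation_mono_pmf_finite finite_law) (use * in auto)
  moreover have "level t \<le> measure_pmf.expectation (law t) (\<lambda>h. real (capacity m))"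
    unfolding level_def expected_alt
    by (intro expectation_mono_pmf_finite finite_law) (use * in auto)
  ultimately show ?thesis by simp
qed

end

section \<open>One-step estimates for independent, identically distributed generation\<close>

locale iid_battery = controlled_battery +
  fixes p :: "vec pmf"
  assumes trans_iid: "x \<in> states m \<Longrightarrow> trans m x = p"
begin

lemma set_p: "set_pmf p \<subseteq> states m"
  using valid trans_states trans_iid by (force simp: valid_model_def)

text \<open>The bound is required for every past \<open>h\<close>, so it covers history-dependent
  policies. It is affine in the level because then its mean depends on the law of the history only
  through \<open>level t\<close>.\<close>

lemma expected_Suc_ge:
  assumes "\<And>h b. b \<in> {0..int (capacity m)} \<Longrightarrow>
    c0 + c1 * real_of_int b \<le> (\<Sum>x\<in>states m. pmf p x * measure_pmf.expectation (\<phi> h x b) (f x b))"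
  shows "c0 + c1 * level t \<le> expected f (Suc t)"
proof -
  have "c0 + c1 * level t = measure_pmf.expectation (law t)
          (\<lambda>h. case hd h of (x, b, a) \<Rightarrow> c0 + c1 * real_of_int (next_level m b a))"
  proof -
    have "c0 + c1 * level t = measure_pmf.expectation (law t)
          (\<lambda>h. c0 + c1 * (case hd h of (x, b, a) \<Rightarrow> real_of_int (next_level m b a)))"
      unfolding level_def expected_alt
      by (simp add: Bochner_Integration.integral_add integrable_measure_pmf_finite finite_law)
    then show ?thesis by (simp add: case_prod_beta)
  qed
  also have "\<dots> \<le> expected f (Suc t)"
    unfolding expected_Suc
  proof (intro expectation_mono_pmf_finite finite_law)
    fix h assume "h \<in> set_pmf (law t)"
    then obtain x b a where h: "hd h = (x, b, a)" "x \<in> states m" "a \<in> allowable m x b"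
      using hd_lawE by metis
    have "measure_pmf.expectation p G = (\<Sum>x\<in>states m. pmf p x * G x)" for G :: "vec \<Rightarrow> real"
      using set_p finite_states
      by (subst integral_measure_pmf_real[of "states m"]) (auto simp: mult.commute)
    then show "(case hd h of (x, b, a) \<Rightarrow> c0 + c1 * real_of_int (next_level m b a)) \<le>
       (case hd h of (x, b, a) \<Rightarrow> measure_pmf.expectation (trans m x) (\<lambda>x'.
         measure_pmf.expectation (\<phi> h x' (next_level m b a)) (f x' (next_level m b a))))"
      using assms[OF next_level_in[OF h(3)]] by (simp add: h trans_iid)
  qed
  finally show ?thesis .
qed

lemma expected_Suc_eq:
  assumes "\<And>h b. b \<in> {0..int (capacity m)} \<Longrightarrow>
    (\<Sum>x\<in>states m. pmf p x * measure_pmf.expectation (\<phi> h x b) (f x b)) = c0 + c1 * real_of_int b"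
  shows "expected f (Suc t) = c0 + c1 * level t"
proof (rule antisym)
  have "- c0 + (- c1) * level t \<le> expected (\<lambda>x b a. (-1) * f x b a) (Suc t)"
    by (rule expected_Suc_ge) (simp add: assms sum_negf)
  then show "expected f (Suc t) \<le> c0 + c1 * level t"
    unfolding expected_cmult by simp
qed (rule expected_Suc_ge, simp add: assms)

text \<open>\<open>w\<close> bounds the cost over all allowable actions, so the remaining condition
  no longer mentions the policy.\<close>

lemma expected_Suc_ge_pointwise:
  assumes "\<And>x b a. x \<in> states m \<Longrightarrow> b \<in> {0..int (capacity m)} \<Longrightarrow> a \<in> allowable m x b \<Longrightarrow>
             w x b \<le> f x b a"
    and "\<And>b. b \<in> {0..int (capacity m)} \<Longrightarrow> c0 + c1 * real_of_int b \<le> (\<Sum>x\<in>states m. pmf p x * w x b)"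
  shows "c0 + c1 * level t \<le> expected f (Suc t)"
proof (rule expected_Suc_ge)
  fix h b assume b: "b \<in> {0..int (capacity m)}"
  have "w x b \<le> measure_pmf.expectation (\<phi> h x b) (f x b)" if x: "x \<in> states m" for x
    using expectation_mono_pmf_finite[OF finite_policy[OF x b], where f = "\<lambda>_. w x b"]
      assms(1)[OF x b] allowed[OF x b] by simp
  then have "(\<Sum>x\<in>states m. pmf p x * w x b) \<le>
      (\<Sum>x\<in>states m. pmf p x * measure_pmf.expectation (\<phi> h x b) (f x b))"
    by (intro sum_mono mult_left_mono) auto
  with assms(2)[OF b] show "c0 + c1 * real_of_int b \<le>
      (\<Sum>x\<in>states m. pmf p x * measure_pmf.expectation (\<phi> h x b) (f x b))" by linarith
qed

text \<open>The recursion has fixed point \<open>\<alpha> / \<gamma>\<close>, and solving it for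
  \<open>level t\<close> leaves the fixed point minus a multiple of an increment. Boundedness of the
  level then suffices; no convergence of the level is needed. For capacity 1 every function of the
  level is affine.\<close>

lemma has_time_average_affine:
  assumes level_step: "\<And>h b. b \<in> {0..int (capacity m)} \<Longrightarrow>
      (\<Sum>x\<in>states m. pmf p x * measure_pmf.expectation (\<phi> h x b) (\<lambda>a. real_of_int (next_level m b a)))
        = \<alpha> + (1 - \<gamma>) * real_of_int b"
    and f_step: "\<And>h b. b \<in> {0..int (capacity m)} \<Longrightarrow>
      (\<Sum>x\<in>states m. pmf p x * measure_pmf.expectation (\<phi> h x b) (f x b)) = c0 + c1 * real_of_int b"
    and "\<gamma> \<noteq> 0"
  shows "has_time_average (expected f) (c0 + c1 * (\<alpha> / \<gamma>))"
proof (rule has_time_average_telescope)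
  show "\<bar>level t\<bar> \<le> real (capacity m)" for t
    using level_in[of t] by auto
  show "expected f (Suc t) = c0 + c1 * (\<alpha> / \<gamma>) + - (c1 / \<gamma>) * (level (Suc t) - level t)" for t
  proof -
    have "level (Suc t) = \<alpha> + (1 - \<gamma>) * level t"
      unfolding level_def[THEN fun_cong, of "Suc t"] by (rule expected_Suc_eq[OF level_step])
    then have "level t = \<alpha> / \<gamma> - (level (Suc t) - level t) / \<gamma>"
      using \<open>\<gamma> \<noteq> 0\<close> by (simp add: field_simps)
    then have "c0 + c1 * level t = c0 + c1 * (\<alpha> / \<gamma> - (level (Suc t) - level t) / \<gamma>)" by simp
    also have "\<dots> = c0 + c1 * (\<alpha> / \<gamma>) + - (c1 / \<gamma>) * (level (Suc t) - level t)"
      by (simp add: right_diff_distrib diff_divide_distrib)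
    finally show ?thesis using expected_Suc_eq[OF f_step] by simp
  qed
qed

text \<open>The dual bound for average cost: \<open>w\<close> underestimates the cost plus the
  potential \<open>c\<close> times the next level, and its mean over the generation dominates
  \<open>g\<close> plus the potential of the current level.\<close>

lemma has_time_average_ge_potential:
  assumes "has_time_average (expected f) L"
    and "\<And>x b a. x \<in> states m \<Longrightarrow> b \<in> {0..int (capacity m)} \<Longrightarrow> a \<in> allowable m x b \<Longrightarrow>
             w x b \<le> f x b a + c * real_of_int (next_level m b a)"
    and "\<And>b. b \<in> {0..int (capacity m)} \<Longrightarrow> g + c * real_of_int b \<le> (\<Sum>x\<in>states m. pmf p x * w x b)"
  shows "g \<le> L"
proof (rule has_time_average_ge_telescope[OF assms(1)])
  show "\<bar>level t\<bar> \<le> real (capacity m)" for t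
    using level_in[of t] by auto
  fix t
  have "g + c * level t \<le> expected (\<lambda>x b a. f x b a + c * real_of_int (next_level m b a)) (Suc t)"
    using assms(2,3) by (rule expected_Suc_ge_pointwise)
  also have "\<dots> = expected f (Suc t) + c * level (Suc t)"
    by (simp add: expected_add expected_cmult level_def)
  finally show "g + - c * (level (Suc t) - level t) \<le> expected f (Suc t)"
    by (simp add: algebra_simps)
qed

lemma has_time_average_LLR_sys:
  assumes "has_LLR_sys m \<nu> \<phi> L"
  shows "has_time_average (expected (\<lambda>x b a. \<Sum>i\<in>users m. load_loss x a i)) L"
proof -
  from assms obtain l where l: "\<And>i. i \<in> users m \<Longrightarrow> has_LLR m \<nu> \<phi> i (l i)" "L = (\<Sum>i\<in>users m. l i)"
    unfolding has_LLR_sys_def by blast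
  have "has_time_average (expected (\<lambda>x b a. load_loss x a i)) (l i)" if "i \<in> users m" for i
    using l(1)[OF that] by (simp add: has_LLR_def expected_def load_loss_def)
  from has_time_average_sum[where I = "users m", OF this] show ?thesis
    by (simp add: l(2) expected_sum[abs_def])
qed

end

section \<open>The two-user instance and its two policies\<close>

definition pair :: "int \<Rightarrow> int \<Rightarrow> vec" where
  "pair u v = (\<lambda>i\<in>{1..2}. if i = 1 then u else v)"

lemma pair_simps [simp]: "pair u v (Suc 0) = u" "pair u v 2 = v"
  by (simp_all add: pair_def)

lemma pair_extensional [simp]: "pair u v \<in> extensional {Suc 0..2}"
  by (simp add: pair_def)

lemma pair_eq_iff [simp]: "pair u v = pair u' v' \<longleftrightarrow> u = u' \<and> v = v'"
  by (metis pair_simps)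

lemma two_users: "{Suc 0..2} = {Suc 0, 2}"
  by auto

definition generation_law :: "real \<Rightarrow> vec pmf" where
  "generation_law \<epsilon> = pmf_of_list [(pair 1 (-1), 3/4 - \<epsilon>), (pair 0 (-1), \<epsilon>), (pair (-1) 4, 1/4)]"

definition two_user_model :: "real \<Rightarrow> battery_model" where
  "two_user_model \<epsilon> = \<lparr>num_users = 2, states = {pair 1 (-1), pair 0 (-1), pair (-1) 4},
     trans = (\<lambda>_. generation_law \<epsilon>), capacity = 1\<rparr>"

lemma two_user_model_simps [simp]:
  "num_users (two_user_model \<epsilon>) = 2" "states (two_user_model \<epsilon>) = {pair 1 (-1), pair 0 (-1), pair (-1) 4}"
  "trans (two_user_model \<epsilon>) = (\<lambda>_. generation_law \<epsilon>)" "capacity (two_user_model \<epsilon>) = 1"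
  by (simp_all add: two_user_model_def)

lemma allowable_two_user_model:
  "a \<in> allowable (two_user_model \<epsilon>) (pair u v) b \<longleftrightarrow>
     a \<in> extensional {Suc 0..2} \<and>
     (if u \<ge> 0 then a (Suc 0) \<in> {0..u} else a (Suc 0) \<in> {u..0}) \<and>
     (if v \<ge> 0 then a 2 \<in> {0..v} else a 2 \<in> {v..0}) \<and>
     0 \<le> b + a (Suc 0) + a 2 \<and> b + a (Suc 0) + a 2 \<le> 1"
  by (auto simp: allowable_def two_users)

lemma next_level_two_user_model: "next_level (two_user_model \<epsilon>) b a = b + a (Suc 0) + a 2"
  by (simp add: next_level_def two_users)

lemma
  assumes "0 < \<epsilon>" "\<epsilon> \<le> 1/4"
  shows pmf_generation_law: "pmf (generation_law \<epsilon>) (pair 1 (-1)) = 3/4 - \<epsilon>" "pmf (generation_law \<epsilon>) (pair 0 (-1)) = \<epsilon>"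
      "pmf (generation_law \<epsilon>) (pair (-1) 4) = 1/4"
    and set_generation_law: "set_pmf (generation_law \<epsilon>) = {pair 1 (-1), pair 0 (-1), pair (-1) 4}"
proof -
  have wf: "pmf_of_list_wf [(pair 1 (-1), 3/4 - \<epsilon>), (pair 0 (-1), \<epsilon>), (pair (-1) 4, 1/4)]"
    using assms by (intro pmf_of_list_wfI) auto
  show "pmf (generation_law \<epsilon>) (pair 1 (-1)) = 3/4 - \<epsilon>" "pmf (generation_law \<epsilon>) (pair 0 (-1)) = \<epsilon>"
      "pmf (generation_law \<epsilon>) (pair (-1) 4) = 1/4"
    by (simp_all add: generation_law_def pmf_pmf_of_list[OF wf])
  show "set_pmf (generation_law \<epsilon>) = {pair 1 (-1), pair 0 (-1), pair (-1) 4}"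
    unfolding generation_law_def using assms by (subst set_pmf_of_list_eq[OF wf]) auto
qed

text \<open>The kernel is constant and charges every state, so any state reaches every state, itself
  included, in one step.\<close>

lemma valid_two_user_model:
  assumes "0 < \<epsilon>" "\<epsilon> \<le> 1/4"
  shows "valid_model (two_user_model \<epsilon>)"
proof -
  have pos: "pmf (generation_law \<epsilon>) x > 0" if "x \<in> states (two_user_model \<epsilon>)" for x
    using that by (simp add: pmf_positive_iff set_generation_law[OF assms])
  then have "irreducible_chain (two_user_model \<epsilon>)"
    unfolding irreducible_chain_def by (intro ballI r_into_rtrancl) simp
  then show ?thesis
    using pos pair_extensional
    by (auto simp: valid_model_def user_values_def two_users set_generation_law[OF assms] simp del: pair_extensional)
qed

lemma stationary_generation_law:
  assumes "0 < \<epsilon>" "\<epsilon> \<le> 1/4"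
  shows "stationary (two_user_model \<epsilon>) (generation_law \<epsilon>)"
  by (simp add: stationary_def set_generation_law[OF assms])

text \<open>The drifts are \<open>1/2 - \<epsilon>\<close> and \<open>1/4\<close>; a burst of 4 is
  the least integer burst for which user 2 gains more than the \<open>3/4\<close> it
  demands.\<close>

lemma drift_two_user_model:
  assumes "0 < \<epsilon>" "\<epsilon> \<le> 1/4" "i \<in> users (two_user_model \<epsilon>)"
  shows "drift (two_user_model \<epsilon>) (generation_law \<epsilon>) i > 0"
  using assms by (auto simp: drift_def two_users pmf_generation_law)

text \<open>On the states of the model the last branch is (-1, 4): user 1 is served and the battery
  is filled, since \<open>b - 1 + (2 - b) = 1\<close>.\<close>

definition greedy_policy :: policy where
  "greedy_policy h x b = return_pmf
     (if x = pair 1 (-1) then pair 1 (-1) else if x = pair 0 (-1) then pair 0 (- b) else pair (-1) (2 - b))"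

text \<open>User 2 first draws on the stored unit, even when user 1 has surplus; only with an empty
  battery does user 1 help, and then with probability \<theta>.\<close>

definition repay_policy :: "real \<Rightarrow> policy" where
  "repay_policy \<theta> h x b =
     (if x = pair 1 (-1) then
        if b = 1 then return_pmf (pair 0 (-1))
        else map_pmf (\<lambda>c. if c then pair 1 (-1) else pair 0 0) (bernoulli_pmf \<theta>)
      else return_pmf (if x = pair 0 (-1) then pair 0 (- b) else pair (-1) (2 - b)))"

lemma greedy_policy_in: "greedy_policy \<in> policies (two_user_model \<epsilon>)"
  by (auto simp: policies_def greedy_policy_def allowable_two_user_model)

lemma repay_policy_in: "repay_policy \<theta> \<in> policies (two_user_model \<epsilon>)"
  by (auto simp: policies_def repay_policy_def allowable_two_user_model)

section \<open>Exact values of the two minima\<close>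

locale two_user_battery =
  fixes \<epsilon> :: real and \<nu> :: "(vec \<times> int) pmf"
  assumes \<epsilon>: "0 < \<epsilon>" "\<epsilon> \<le> 1/4"
    and initial: "initial_distribution (two_user_model \<epsilon>) \<nu>"
begin

lemma iid_battery: "\<phi> \<in> policies (two_user_model \<epsilon>) \<Longrightarrow> iid_battery (two_user_model \<epsilon>) \<nu> \<phi> (generation_law \<epsilon>)"
  using initial valid_two_user_model[OF \<epsilon>]
  by (simp add: iid_battery_def iid_battery_axioms_def controlled_battery_def)

text \<open>Under the greedy policy a full battery is emptied with probability \<epsilon> and an
  empty one filled with probability \<open>1/4\<close>, so it is empty for a fraction
  \<open>\<epsilon> / (1/4 + \<epsilon>)\<close> of the time; a unit is lost when this meets (0,
  -1).\<close>

lemma LLR_e: "is_LLR_e (two_user_model \<epsilon>) \<nu> (\<epsilon>\<^sup>2 / (1/4 + \<epsilon>))"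
  unfolding is_LLR_e_def is_minimum_def
proof (intro conjI ballI)
  let ?m = "two_user_model \<epsilon>"
  interpret iid_battery ?m \<nu> greedy_policy "generation_law \<epsilon>"
    by (rule iid_battery[OF greedy_policy_in])
  have loss: "has_time_average (expected (\<lambda>x b a. load_loss x a i))
      ((if i = 1 then 0 else \<epsilon>) + (if i = 1 then 0 else - \<epsilon>) * ((1/4) / (1/4 + \<epsilon>)))"
    if "i \<in> users ?m" for i
    using that \<epsilon>
    by (intro has_time_average_affine)
       (auto simp: greedy_policy_def next_level_two_user_model pmf_generation_law load_loss_def two_users field_simps)
  have "has_LLR_sys ?m \<nu> greedy_policy (\<epsilon>\<^sup>2 / (1/4 + \<epsilon>))"
    unfolding has_LLR_sys_def
  proof (intro exI conjI ballI)
    show "has_LLR ?m \<nu> greedy_policy i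
      ((if i = 1 then 0 else \<epsilon>) + (if i = 1 then 0 else - \<epsilon>) * ((1/4) / (1/4 + \<epsilon>)))"
      if "i \<in> users ?m" for i
      using loss[OF that] by (simp add: has_LLR_def expected_def load_loss_def)
    show "\<epsilon>\<^sup>2 / (1/4 + \<epsilon>) = (\<Sum>i\<in>users ?m.
      (if i = 1 then 0 else \<epsilon>) + (if i = 1 then 0 else - \<epsilon>) * ((1/4) / (1/4 + \<epsilon>)))"
      using \<epsilon> by (simp add: two_users field_simps power2_eq_square)
  qed
  then show "\<epsilon>\<^sup>2 / (1/4 + \<epsilon>) \<in> {L. \<exists>\<phi>\<in>policies ?m. has_LLR_sys ?m \<nu> \<phi> L}"
    using greedy_policy_in by blast
next
  let ?m = "two_user_model \<epsilon>"
  fix L assume "L \<in> {L. \<exists>\<phi>\<in>policies ?m. has_LLR_sys ?m \<nu> \<phi> L}"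
  then obtain \<phi> where \<phi>: "\<phi> \<in> policies ?m" and L: "has_LLR_sys ?m \<nu> \<phi> L" by blast
  interpret iid_battery ?m \<nu> \<phi> "generation_law \<epsilon>"
    by (rule iid_battery[OF \<phi>])
  \<comment> \<open>\<open>c\<close> is the value of a stored unit: it makes the bound below independent of the battery level.\<close>
  define c where "c = \<epsilon> / (1/4 + \<epsilon>)"
  have pos: "1/4 + \<epsilon> > 0" using \<epsilon> by simp
  then have c: "0 \<le> c" "c \<le> 1" using \<epsilon> by (simp_all add: c_def)
  have "c * (1/4 + \<epsilon>) = \<epsilon>" unfolding c_def using pos by simp
  then have c_eq: "c / 4 + \<epsilon> * c = \<epsilon>" by (simp add: algebra_simps)
  have "\<epsilon>\<^sup>2 / (1/4 + \<epsilon>) = \<epsilon> * c" by (simp add: c_def power2_eq_square)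
  with c_eq have g: "\<epsilon>\<^sup>2 / (1/4 + \<epsilon>) = \<epsilon> - c / 4" by simp
  \<comment> \<open>The least loss minus \<open>c\<close> times the next level, state by state: pass
    the unit through, serve from the battery if possible, fill the battery. Because
    \<open>c \<le> 1\<close>, withholding energy from a load never pays.\<close>
  let ?w = "\<lambda>x b. if x = pair 1 (-1) then - c * real_of_int b
                 else if x = pair 0 (-1) then 1 - real_of_int b else - c"
  show "\<epsilon>\<^sup>2 / (1/4 + \<epsilon>) \<le> L"
  proof (rule has_time_average_ge_potential[OF has_time_average_LLR_sys[OF L], where c = "- c" and w = ?w])
    fix x b a
    assume x: "x \<in> states ?m" and b: "b \<in> {0..int (capacity ?m)}" and a: "a \<in> allowable ?m x b"
    consider "x = pair 1 (-1)" | "x = pair 0 (-1)" | "x = pair (-1) 4"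
      using x by auto
    then show "?w x b \<le> (\<Sum>i\<in>users ?m. load_loss x a i) + - c * real_of_int (next_level ?m b a)"
    proof cases
      case 1
      with a have "a (Suc 0) \<in> {0, 1}" "a 2 \<in> {-1, 0}" by (auto simp: allowable_two_user_model)
      then show ?thesis using c a 1
        by (auto simp: load_loss_def next_level_two_user_model two_users allowable_two_user_model algebra_simps)
    next
      case 2
      with a have "a (Suc 0) = 0" "a 2 \<in> {-1, 0}" "b \<in> {0, 1}" using b by (auto simp: allowable_two_user_model)
      then show ?thesis using c a 2
        by (auto simp: load_loss_def next_level_two_user_model two_users allowable_two_user_model algebra_simps)
    next
      case 3
      have "next_level ?m b a \<le> 1" using next_level_in[OF a] by simp
      then have "c * real_of_int (next_level ?m b a) \<le> c"
        using c by (intro mult_left_le) auto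
      then show ?thesis using a 3
        by (auto simp: load_loss_def two_users allowable_two_user_model)
    qed
  next
    fix b
    have "(\<Sum>x\<in>states ?m. pmf (generation_law \<epsilon>) x * ?w x b)
        = \<epsilon> - c / 4 - (3/4 * c - \<epsilon> * c + \<epsilon>) * real_of_int b"
      by (simp add: pmf_generation_law[OF \<epsilon>] algebra_simps)
    also have "3/4 * c - \<epsilon> * c + \<epsilon> = c" using c_eq by simp
    finally show "\<epsilon>\<^sup>2 / (1/4 + \<epsilon>) + - c * real_of_int b
        \<le> (\<Sum>x\<in>states ?m. pmf (generation_law \<epsilon>) x * ?w x b)"
      by (simp add: g)
  qed
qed

text \<open>User 2 demands at rate \<open>3/4\<close>. A burst, of probability \<open>1/4\<close>,
  lets it contribute at most \<open>2 - b\<close>; with mean level \<open>1/4\<close> this is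
  \<open>7/16\<close> per step, and fairness caps its supply there:
  \<open>3/4 - 7/16 = 5/16\<close>.\<close>

lemma LLR_o: "is_LLR_o (two_user_model \<epsilon>) \<nu> (5/16)"
  unfolding is_LLR_o_def is_minimum_def
proof (intro conjI ballI)
  let ?m = "two_user_model \<epsilon>"
  \<comment> \<open>The battery is full exactly after state \<open>(-1, 4)\<close>, hence with probability \<open>1/4\<close>, and \<open>\<theta>\<close> solves
    \<open>(3/4 - \<epsilon>) * 3/4 * \<theta> = 1/4\<close>: user 1 gives as much as it receives.\<close>
  define \<theta> where "\<theta> = (1/3) / (3/4 - \<epsilon>)"
  have \<theta>: "0 \<le> \<theta>" "\<theta> \<le> 1" "3/4 * \<theta> - \<epsilon> * \<theta> = 1/3"
  proof -
    have pos: "3/4 - \<epsilon> > 0" using \<epsilon> by simp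
    then show "0 \<le> \<theta>" "\<theta> \<le> 1" using \<epsilon> by (simp_all add: \<theta>_def field_simps)
    have "(3/4 - \<epsilon>) * \<theta> = 1/3" unfolding \<theta>_def using pos by simp
    then show "3/4 * \<theta> - \<epsilon> * \<theta> = 1/3" by (simp only: left_diff_distrib)
  qed
  interpret iid_battery ?m \<nu> "repay_policy \<theta>" "generation_law \<epsilon>"
    by (rule iid_battery[OF repay_policy_in])
  note sims = repay_policy_def next_level_two_user_model pmf_generation_law[OF \<epsilon>] load_loss_def two_users
    algebra_simps diff_divide_distrib
  have level_step: "(\<Sum>x\<in>states ?m. pmf (generation_law \<epsilon>) x *
      measure_pmf.expectation (repay_policy \<theta> h x b) (\<lambda>a. real_of_int (next_level ?m b a)))
        = 1/4 + (1 - 1) * real_of_int b" if "b \<in> {0..int (capacity ?m)}" for h b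
  proof -
    have "b = 0 \<or> b = 1" using that by auto
    then show ?thesis using \<theta> by (auto simp: sims)
  qed
  \<comment> \<open>With an empty battery user 2 loses
    \<open>(3/4 - \<epsilon>) * (1 - \<theta>) + \<epsilon> = 5/12\<close> on average, with a full
    one nothing.\<close>
  have loss: "has_time_average (expected (\<lambda>x b a. load_loss x a i))
      ((if i = 1 then 0 else 5/12) + (if i = 1 then 0 else - (5/12)) * ((1/4) / 1))"
    if "i \<in> users ?m" for i
  proof (rule has_time_average_affine[OF level_step])
    fix h b assume "b \<in> {0..int (capacity ?m)}"
    then have "b = 0 \<or> b = 1" by auto
    with that show "(\<Sum>x\<in>states ?m. pmf (generation_law \<epsilon>) x *
      measure_pmf.expectation (repay_policy \<theta> h x b) (\<lambda>a. load_loss x a i))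
        = (if i = 1 then 0 else 5/12) + (if i = 1 then 0 else - (5/12)) * real_of_int b"
      using \<theta> by (auto simp: sims)
  qed auto
  \<comment> \<open>Interpolation between the mean actions at levels 0 and 1: \<open>1/12\<close>
    and \<open>-1/4\<close> for user 1, \<open>1/6\<close> and \<open>-1/2\<close> for user 2. At
    mean level \<open>1/4\<close> both balances are 0.\<close>
  have balance: "has_time_average (expected (\<lambda>x b a. real_of_int (a i)))
      ((if i = 1 then 1/12 else 1/6) + (if i = 1 then - (1/3) else - (2/3)) * ((1/4) / 1))"
    if "i \<in> users ?m" for i
  proof (rule has_time_average_affine[OF level_step])
    fix h b assume "b \<in> {0..int (capacity ?m)}"
    then have "b = 0 \<or> b = 1" by auto
    with that show "(\<Sum>x\<in>states ?m. pmf (generation_law \<epsilon>) x *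
      measure_pmf.expectation (repay_policy \<theta> h x b) (\<lambda>a. real_of_int (a i)))
        = (if i = 1 then 1/12 else 1/6) + (if i = 1 then - (1/3) else - (2/3)) * real_of_int b"
      using \<theta> by (auto simp: sims)
  qed auto
  have "fair ?m \<nu> (repay_policy \<theta>)"
    unfolding fair_def
  proof (intro ballI exI conjI)
    fix i assume "i \<in> users ?m"
    then show "has_time_average (expect_at ?m \<nu> (repay_policy \<theta>) (\<lambda>x b a. real_of_int (a i))) 0"
      using balance[of i] by (auto simp: expected_def split: if_splits)
  qed simp
  moreover have "has_LLR_sys ?m \<nu> (repay_policy \<theta>) (5/16)"
    unfolding has_LLR_sys_def
  proof (intro exI conjI ballI)
    show "has_LLR ?m \<nu> (repay_policy \<theta>) i
      ((if i = 1 then 0 else 5/12) + (if i = 1 then 0 else - (5/12)) * ((1/4) / 1))"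
      if "i \<in> users ?m" for i
      using loss[OF that] by (simp add: has_LLR_def expected_def load_loss_def)
    show "5/16 = (\<Sum>i\<in>users ?m.
      (if i = 1 then 0 else 5/12) + (if i = 1 then 0 else - (5/12)) * ((1/4) / 1 :: real))"
      by (simp add: two_users)
  qed
  ultimately show "5/16 \<in> {L. \<exists>\<phi>\<in>policies ?m. fair ?m \<nu> \<phi> \<and> has_LLR_sys ?m \<nu> \<phi> L}"
    using repay_policy_in by blast
next
  let ?m = "two_user_model \<epsilon>"
  fix L assume "L \<in> {L. \<exists>\<phi>\<in>policies ?m. fair ?m \<nu> \<phi> \<and> has_LLR_sys ?m \<nu> \<phi> L}"
  then obtain \<phi> where \<phi>: "\<phi> \<in> policies ?m" and fair: "fair ?m \<nu> \<phi>" and L: "has_LLR_sys ?m \<nu> \<phi> L"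
    by blast
  interpret iid_battery ?m \<nu> \<phi> "generation_law \<epsilon>"
    by (rule iid_battery[OF \<phi>])
  obtain d where d: "d \<ge> 0" "has_time_average (expected (\<lambda>x b a. real_of_int (a 2))) d"
    using fair by (auto simp: fair_def expected_def two_users)
  \<comment> \<open>Multiplier 1 for the fairness of user 2: when user 2 is in deficit, its loss
    \<open>a 2 + 1\<close> minus \<open>a 2\<close> is 1 whatever the action, so only the burst
    state leaves a choice.\<close>
  let ?f = "\<lambda>x (b::int) a. (\<Sum>i\<in>users ?m. load_loss x a i) + (-1) * real_of_int (a 2)"
  \<comment> \<open>The burst value is attained at \<open>(-1, 2 - b)\<close>: no loss,
    \<open>-(2 - b)\<close> from the multiplier, \<open>1/4\<close> from the full battery. Averaging
    gives \<open>3/4 + 1/4 * (b - 7/4) = 5/16 + b/4\<close>, so the potential has slope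
    \<open>1/4\<close>, the burst probability.\<close>
  let ?w = "\<lambda>x b. if x = pair (-1) 4 then real_of_int b - 7/4 else 1"
  have "has_time_average (expected ?f) (L - d)"
    using has_time_average_diff[OF has_time_average_LLR_sys[OF L] d(2)]
    by (simp only: expected_add[abs_def] expected_cmult) simp
  then have "5/16 \<le> L - d"
  proof (rule has_time_average_ge_potential[where c = "1/4" and w = ?w])
    fix x b a
    assume x: "x \<in> states ?m" and b: "b \<in> {0..int (capacity ?m)}" and a: "a \<in> allowable ?m x b"
    show "?w x b \<le> ?f x b a + 1/4 * real_of_int (next_level ?m b a)"
    proof (cases "x = pair (-1) 4")
      case True
      with a have "real_of_int (a (Suc 0)) \<ge> - 1" "real_of_int (b + a (Suc 0) + a 2) \<le> 1"
        by (simp_all add: allowable_two_user_model)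
      with True show ?thesis
        by (simp add: load_loss_def next_level_two_user_model two_users field_simps)
    next
      case False
      with x a show ?thesis
        by (auto simp: load_loss_def next_level_two_user_model two_users allowable_two_user_model)
    qed
  qed (simp add: pmf_generation_law[OF \<epsilon>] field_simps)
  with d(1) show "5/16 \<le> L" by linarith
qed

end

theorem mainTheorem4:
  fixes M :: real
  assumes "M > 0"
  shows "\<exists>m p. valid_model m \<and> stationary m p \<and> (\<forall>i\<in>users m. drift m p i > 0) \<and>
           (\<forall>\<nu>. initial_distribution m \<nu> \<longrightarrow> (\<exists>q. is_PoF m \<nu> q \<and> q \<ge> M))"
proof -
  \<comment> \<open>The ratio is \<open>5/16 * (1/4 + \<epsilon>) / \<epsilon>\<^sup>2\<close>. The
    weaker bound \<open>5 / (16 * \<epsilon>)\<close> already exceeds \<open>M\<close> once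
    \<open>\<epsilon> * M \<le> 1/4\<close>; adding 1 to \<open>M\<close> also secures
    \<open>\<epsilon> \<le> 1/4\<close>.\<close>
  define \<epsilon> where "\<epsilon> = 1 / (4 * (1 + M))"
  have \<epsilon>: "0 < \<epsilon>" "\<epsilon> \<le> 1/4" and M: "\<epsilon> * M \<le> 1/4"
    using assms by (simp_all add: \<epsilon>_def field_simps)
  have "\<exists>q. is_PoF (two_user_model \<epsilon>) \<nu> q \<and> q \<ge> M" if "initial_distribution (two_user_model \<epsilon>) \<nu>" for \<nu>
  proof (intro exI conjI)
    interpret two_user_battery \<epsilon> \<nu>
      using \<epsilon> that by unfold_locales
    show "is_PoF (two_user_model \<epsilon>) \<nu> ((5/16) / (\<epsilon>\<^sup>2 / (1/4 + \<epsilon>)))"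
      unfolding is_PoF_def
    proof (intro exI conjI)
      show "\<epsilon>\<^sup>2 / (1/4 + \<epsilon>) \<noteq> 0" using \<epsilon> by simp
    qed (rule LLR_o LLR_e refl)+
    have "M * \<epsilon>\<^sup>2 = (\<epsilon> * M) * \<epsilon>" by (simp add: power2_eq_square)
    also have "\<dots> \<le> 1/4 * \<epsilon>" using M \<epsilon> by (intro mult_right_mono) auto
    also have "\<dots> \<le> 5/16 * (1/4 + \<epsilon>)" using \<epsilon> by simp
    finally show "M \<le> (5/16) / (\<epsilon>\<^sup>2 / (1/4 + \<epsilon>))"
      using \<epsilon> by (simp add: field_simps)
  qed
  then show ?thesis
    using valid_two_user_model[OF \<epsilon>] stationary_generation_law[OF \<epsilon>] drift_two_user_model[OF \<epsilon>] by blast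
qed

end
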